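(* Let $A$ be a graph of order $n$ and let $X=(m_{ij})$ be its stable graph obtained by the SaS process, with vertex partition $\mathcal C$ (vertices $u,v$ in the same cell iff $m_{uu}=m_{vv}$). Then: (1) $\mathcal C$ is a strongly equitable partition of $X$; (2) if $\{u\}$ is a singleton cell of $\mathcal C$, then for every cell $C_v=\{v_1,\dots,v_s\}$ of $\mathcal C$ one has $m_{uv_1}=\cdots=m_{uv_s}$; (3) for any two cells $C_u,C_v$ of $\mathcal C$, the number of neighbours in $A$ lying in $C_v$ of a vertex $w\in C_u$ does not depend on the choice of $w\in C_u$.
   Context: Labels are independent commuting indeterminates $x_0,x_1,\dots$; $\mathrm{Var}=\{x_1,x_2,\dots\}$. A graph of order $n$ is a symmetric $n\times n$ matrix $(a_{ij})$ over $\{x_0\}\cup\mathrm{Var}$ on vertex set $[n]$; $a_{ii}$ is the label of vertex $i$; for $i\neq j$, $j$ is a neighbour of $i$ iff $a_{ij}\ne x_0$. $\dim$ is the number of distinct entries. An equivalent variable substitution replaces the entries of a matrix by variables of $\mathrm{Var}$, equal entries by equal variables, distinct by distinct. SaS process: $A_1$ is $A$ with its diagonal entries replaced by an equivalent variable substitution using fresh variables not occurring off the diagonal; $A_{i+1}$ is obtained from $A_i^2$ (computed in the commutative polynomial ring) by an equivalent variable substitution; at the first $t$ with $\dim(A_t)=\dim(A_{t+1})$ the stable graph is $A_t$. A partition $\mathcal C=(C_1,\dots,C_p)$ of $[n]$ in which vertices with equal labels are in the same cell is equitable for a graph $(a_{ij})$ if for all cells $C_u=\{u_1,\dots,u_r\}$,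 $C_v=\{v_1,\dots,v_s\}$ and all $i,j$: the multisets $\{\!\{a_{u_iv_k}:k\in[s]\}\!\}$ and $\{\!\{a_{u_jv_k}:k\in[s]\}\!\}$ are equal, and $\{\!\{a_{u_kv_i}:k\in[r]\}\!\}=\{\!\{a_{u_kv_j}:k\in[r]\}\!\}$. It is strongly equitable if moreover for all cells $C_u,C_v,C_w$ with $C_v\ne C_w$ (with $C_w=\{w_1,\dots,w_t\}$), $\{\!\{a_{u_1v_k}:k\in[s]\}\!\}\cap\{\!\{a_{u_1w_k}:k\in[t]\}\!\}=\{\!\{a_{v_ku_1}:k\in[s]\}\!\}\cap\{\!\{a_{w_ku_1}:k\in[t]\}\!\}=\emptyset$. *)

theory Defs
  imports
    "Jordan_Normal_Form.Matrix"
    "HOL-Library.Poly_Mapping"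
    "HOL-Library.Multiset"
    "HOL-Library.Disjoint_Sets"
begin

text \<open>
  The commutative polynomial ring over the integers in countably many indeterminates:
  the inner finitely supported maps are monomials (exponent vectors), the outer ones assign
  coefficients to monomials, and the library's multiplication is the convolution product.
\<close>

type_synonym label_poly = "(nat \<Rightarrow>\<^sub>0 nat) \<Rightarrow>\<^sub>0 int"

definition indet :: "nat \<Rightarrow> label_poly" where
  "indet i = Poly_Mapping.single (Poly_Mapping.single i 1) 1"

definition Var :: "label_poly set" where
  "Var = indet ` {1..}"

text \<open>Vertices are numbered from 0, so the vertex set of a graph of order n is \<open>{0..<n}\<close>.\<close>

definition is_graph :: "nat \<Rightarrow> label_poly mat \<Rightarrow> bool" where
  "is_graph n A \<longleftrightarrow>
     A \<in> carrier_mat n n \<and> transpose_mat A = A \<and> elements_mat A \<subseteq> insert (indet 0) Var"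

definition neighbours :: "label_poly mat \<Rightarrow> nat \<Rightarrow> nat set" where
  "neighbours A i = {j. j < dim_row A \<and> j \<noteq> i \<and> A $$ (i, j) \<noteq> indet 0}"

definition mat_dim :: "'a mat \<Rightarrow> nat" where
  "mat_dim A = card (elements_mat A)"

definition equiv_subst :: "label_poly mat \<Rightarrow> label_poly mat \<Rightarrow> bool" where
  "equiv_subst B C \<longleftrightarrow>
     C \<in> carrier_mat (dim_row B) (dim_col B) \<and> elements_mat C \<subseteq> Var \<and>
     (\<forall>i < dim_row B. \<forall>j < dim_col B. \<forall>k < dim_row B. \<forall>l < dim_col B.
        C $$ (i, j) = C $$ (k, l) \<longleftrightarrow> B $$ (i, j) = B $$ (k, l))"

definition diag_equiv_subst :: "nat \<Rightarrow> label_poly mat \<Rightarrow> label_poly mat \<Rightarrow> bool" where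
  "diag_equiv_subst n A B \<longleftrightarrow>
     B \<in> carrier_mat n n \<and>
     (\<forall>i < n. \<forall>j < n. i \<noteq> j \<longrightarrow> B $$ (i, j) = A $$ (i, j)) \<and>
     (\<forall>i < n. B $$ (i, i) \<in> Var) \<and>
     (\<forall>i < n. \<forall>j < n. B $$ (i, i) = B $$ (j, j) \<longleftrightarrow> A $$ (i, i) = A $$ (j, j)) \<and>
     (\<forall>i < n. \<forall>j < n. \<forall>k < n. j \<noteq> k \<longrightarrow> B $$ (i, i) \<noteq> A $$ (j, k))"

text \<open>
  Substitutions are not unique, so the process is a predicate on sequences.  The sequence starts
  at index 1 (the value at 0 is irrelevant) and is allowed to continue past the stable graph.
\<close>

definition SaS_sequence :: "nat \<Rightarrow> label_poly mat \<Rightarrow> (nat \<Rightarrow> label_poly mat) \<Rightarrow> bool" where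
  "SaS_sequence n A S \<longleftrightarrow>
     diag_equiv_subst n A (S 1) \<and> (\<forall>i \<ge> 1. equiv_subst (S i ^\<^sub>m 2) (S (i + 1)))"

definition is_stable_graph :: "nat \<Rightarrow> label_poly mat \<Rightarrow> label_poly mat \<Rightarrow> bool" where
  "is_stable_graph n A X \<longleftrightarrow>
     (\<exists>S t. SaS_sequence n A S \<and> t \<ge> 1 \<and> mat_dim (S t) = mat_dim (S (t + 1)) \<and>
        (\<forall>s. 1 \<le> s \<and> s < t \<longrightarrow> mat_dim (S s) \<noteq> mat_dim (S (s + 1))) \<and> X = S t)"

definition vertex_partition :: "nat \<Rightarrow> 'a mat \<Rightarrow> nat set set" where
  "vertex_partition n M = (\<lambda>u. {v \<in> {0..<n}. M $$ (v, v) = M $$ (u, u)}) ` {0..<n}"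

definition row_labels :: "'a mat \<Rightarrow> nat \<Rightarrow> nat set \<Rightarrow> 'a multiset" where
  "row_labels M u C = image_mset (\<lambda>v. M $$ (u, v)) (mset_set C)"

definition col_labels :: "'a mat \<Rightarrow> nat set \<Rightarrow> nat \<Rightarrow> 'a multiset" where
  "col_labels M C v = image_mset (\<lambda>u. M $$ (u, v)) (mset_set C)"

definition equitable :: "nat \<Rightarrow> 'a mat \<Rightarrow> nat set set \<Rightarrow> bool" where
  "equitable n M P \<longleftrightarrow>
     partition_on {0..<n} P \<and>
     (\<forall>i < n. \<forall>j < n. M $$ (i, i) = M $$ (j, j) \<longrightarrow> (\<exists>C \<in> P. i \<in> C \<and> j \<in> C)) \<and>
     (\<forall>Cu \<in> P. \<forall>Cv \<in> P.
        (\<forall>i \<in> Cu. \<forall>j \<in> Cu. row_labels M i Cv = row_labels M j Cv) \<and>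
        (\<forall>i \<in> Cv. \<forall>j \<in> Cv. col_labels M Cu i = col_labels M Cu j))"

text \<open>
  The disjointness condition is imposed at every vertex of the cell \<open>Cu\<close> rather than at a
  chosen representative; for equitable partitions the multisets do not depend on that choice.
\<close>

definition strongly_equitable :: "nat \<Rightarrow> 'a mat \<Rightarrow> nat set set \<Rightarrow> bool" where
  "strongly_equitable n M P \<longleftrightarrow>
     equitable n M P \<and>
     (\<forall>Cu \<in> P. \<forall>Cv \<in> P. \<forall>Cw \<in> P. Cv \<noteq> Cw \<longrightarrow>
        (\<forall>u \<in> Cu. row_labels M u Cv \<inter># row_labels M u Cw = {#} \<and>
                  col_labels M Cv u \<inter># col_labels M Cw u = {#}))"

end

theory Submission
  imports Defs
begin

text \<open>
  The entry \<open>(u, v)\<close> of the square of a graph is a polynomial encoding the multiset of unordered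
  label pairs read along the walks of length 2 from \<open>u\<close> to \<open>v\<close>.  Since diagonal labels never occur
  off the diagonal, the pairs containing a diagonal label reveal the old label of \<open>(u, v)\<close> and the
  unordered pair of labels of \<open>u\<close> and \<open>v\<close>.  Hence each step refines the previous labelling, and as
  soon as the dimension stops growing the labelling is a fixed point.  There, a vertex label
  determines the multiset of labels in its row, and the label of an edge together with one end
  determines the cell of the other end.
\<close>

section \<open>Entries of squared graphs as multisets of label pairs\<close>

definition walk_pairs :: "nat \<Rightarrow> 'a mat \<Rightarrow> nat \<Rightarrow> nat \<Rightarrow> 'a multiset multiset" where
  "walk_pairs n M u v = image_mset (\<lambda>k. {#M $$ (u, k), M $$ (k, v)#}) (mset_set {0..<n})"

lemma in_walk_pairs_iff:
  "p \<in># walk_pairs n M u v \<longleftrightarrow> (\<exists>k<n. p = {#M $$ (u, k), M $$ (k, v)#})"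
  by (auto simp: walk_pairs_def)

lemma mset_pair_eq_iff:
  "{#a, b#} = {#c, d#} \<longleftrightarrow> a = c \<and> b = d \<or> a = d \<and> b = c"
  by (auto simp: add_eq_conv_diff)

lemma single_add_single_eqD:
  assumes "Poly_Mapping.single a (1::nat) + Poly_Mapping.single b 1 =
    Poly_Mapping.single c 1 + Poly_Mapping.single d 1"
  shows "{#a, b#} = {#c, d#}"
proof (rule multiset_eqI)
  fix x
  have "Poly_Mapping.lookup (Poly_Mapping.single a (1::nat) + Poly_Mapping.single b 1) x =
      Poly_Mapping.lookup (Poly_Mapping.single c 1 + Poly_Mapping.single d 1) x"
    using assms by simp
  then show "count {#a, b#} x = count {#c, d#} x"
    by (auto simp: lookup_add lookup_single when_def split: if_splits)
qed

text \<open>All coefficients are 1, so nothing cancels and each coefficient of the sum counts how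
  often its monomial occurs.\<close>

lemma lookup_sum_monomials:
  "Poly_Mapping.lookup (\<Sum>k\<in>K. Poly_Mapping.single (m k) (1::int)) x =
    int (count (image_mset m (mset_set K)) x)"
proof (cases "finite K")
  case True
  then show ?thesis
    by (induction K) (auto simp: lookup_add lookup_single when_def)
qed simp

text \<open>Comparing coefficients yields equal multisets of monomials, and a monomial of degree two
  determines its unordered pair of factors.\<close>

lemma sum_indet_products_eqD:
  assumes "(\<Sum>k\<in>K. indet (a k) * indet (b k)) = (\<Sum>k\<in>L. indet (c k) * indet (d k))"
  shows "image_mset (\<lambda>k. {#a k, b k#}) (mset_set K) = image_mset (\<lambda>k. {#c k, d k#}) (mset_set L)"
proof -
  let ?mon = "\<lambda>a b :: nat. Poly_Mapping.single a (1::nat) + Poly_Mapping.single b 1"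
  \<comment> \<open>\<open>dec\<close> reads the unordered pair off a monomial; uniqueness in the
    description operator is \<open>single_add_single_eqD\<close>.\<close>
  define dec :: "(nat \<Rightarrow>\<^sub>0 nat) \<Rightarrow> nat multiset"
    where "dec m = (THE p. \<exists>a b. m = ?mon a b \<and> p = {#a, b#})" for m
  have dec: "dec (?mon a b) = {#a, b#}" for a b :: nat
    unfolding dec_def by (rule the_equality) (blast, metis single_add_single_eqD)
  have prod: "indet i * indet j = Poly_Mapping.single (?mon i j) 1" for i j
    by (simp add: indet_def mult_single)
  have "image_mset (\<lambda>k. ?mon (a k) (b k)) (mset_set K) =
      image_mset (\<lambda>k. ?mon (c k) (d k)) (mset_set L)"
  proof (rule multiset_eqI)
    fix x
    show "count (image_mset (\<lambda>k. ?mon (a k) (b k)) (mset_set K)) x =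
        count (image_mset (\<lambda>k. ?mon (c k) (d k)) (mset_set L)) x"
      using arg_cong[OF assms, of "\<lambda>p. Poly_Mapping.lookup p x"]
      by (simp only: prod lookup_sum_monomials of_nat_eq_iff)
  qed
  then have "image_mset dec (image_mset (\<lambda>k. ?mon (a k) (b k)) (mset_set K)) =
      image_mset dec (image_mset (\<lambda>k. ?mon (c k) (d k)) (mset_set L))"
    by simp
  then show ?thesis
    by (simp add: multiset.map_comp comp_def dec del: One_nat_def)
qed

lemma index_pow_mat_2:
  assumes "M \<in> carrier_mat n n" "u < n" "v < n"
  shows "(M ^\<^sub>m 2) $$ (u, v) = (\<Sum>k\<in>{0..<n}. M $$ (u, k) * M $$ (k, v))"
proof -
  have "M ^\<^sub>m 2 = M * M"
    using assms(1) by (simp add: numeral_2_eq_2)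
  then show ?thesis
    using assms by (auto simp: scalar_prod_def intro!: sum.cong)
qed

text \<open>This passes from polynomials to combinatorics. The entries are allowed in
  \<open>range indet\<close> rather than \<open>Var\<close>, since \<open>indet 0\<close> may
  survive off the diagonal of the first graph of the process.\<close>

lemma pow_mat_2_eq_imp_walk_pairs_eq:
  assumes M: "M \<in> carrier_mat n n" and var: "elements_mat M \<subseteq> range indet"
    and lt: "u < n" "v < n" "u' < n" "v' < n"
    and eq: "(M ^\<^sub>m 2) $$ (u, v) = (M ^\<^sub>m 2) $$ (u', v')"
  shows "walk_pairs n M u v = walk_pairs n M u' v'"
proof -
  define e where "e i j = inv_into UNIV indet (M $$ (i, j))" for i j
  have e: "M $$ (i, j) = indet (e i j)" if "i < n" "j < n" for i j
  proof -
    have "M $$ (i, j) \<in> range indet"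
      using that M var by (force simp: elements_mat_def)
    then show ?thesis
      by (simp add: e_def f_inv_into_f)
  qed
  have wp: "walk_pairs n M i j =
      image_mset (image_mset indet) (image_mset (\<lambda>k. {#e i k, e k j#}) (mset_set {0..<n}))"
    if "i < n" "j < n" for i j
    unfolding walk_pairs_def using that
    by (auto simp: multiset.map_comp comp_def e intro!: image_mset_cong)
  have "(\<Sum>k\<in>{0..<n}. indet (e u k) * indet (e k v)) =
      (\<Sum>k\<in>{0..<n}. indet (e u' k) * indet (e k v'))"
    using eq lt by (simp add: index_pow_mat_2[OF M] e)
  from sum_indet_products_eqD[OF this] show ?thesis
    using lt by (simp only: wp)
qed

text \<open>Since \<open>g\<close> refines \<open>h\<close>, the map \<open>h\<close> factors
  through \<open>g\<close>; the factor map is a surjection between finite sets of equal size, hence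
  injective.\<close>

lemma kernel_eq_if_card_image_eq:
  assumes "finite P" and refine: "\<And>p q. p \<in> P \<Longrightarrow> q \<in> P \<Longrightarrow> g p = g q \<Longrightarrow> h p = h q"
    and card: "card (g ` P) = card (h ` P)" and pq: "p \<in> P" "q \<in> P" "h p = h q"
  shows "g p = g q"
proof -
  \<comment> \<open>The factor map evaluates \<open>h\<close> at a chosen preimage under
    \<open>g\<close>; by \<open>refine\<close> the choice does not matter.\<close>
  define f where "f y = h (SOME p. p \<in> P \<and> g p = y)" for y
  have f: "f (g p) = h p" if "p \<in> P" for p
  proof -
    have "(SOME r. r \<in> P \<and> g r = g p) \<in> P \<and> g (SOME r. r \<in> P \<and> g r = g p) = g p"
      using that by (intro someI[of "\<lambda>r. r \<in> P \<and> g r = g p" p]) simp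
    then show ?thesis
      unfolding f_def using refine that by blast
  qed
  have "f ` g ` P = h ` P"
    using f by (force simp: image_image)
  then have "inj_on f (g ` P)"
    using assms(1) card by (intro eq_card_imp_inj_on) auto
  moreover have "f (g p) = f (g q)"
    using pq f by simp
  ultimately show ?thesis
    using pq by (auto dest: inj_onD)
qed

section \<open>Symmetric labellings whose diagonal labels never occur off the diagonal\<close>

locale diag_separated =
  fixes n :: nat and M :: "'a mat"
  assumes carrier: "M \<in> carrier_mat n n"
    and sym: "\<And>i j. i < n \<Longrightarrow> j < n \<Longrightarrow> M $$ (i, j) = M $$ (j, i)"
    and diag: "\<And>i j k. i < n \<Longrightarrow> j < n \<Longrightarrow> k < n \<Longrightarrow> j \<noteq> k \<Longrightarrow> M $$ (i, i) \<noteq> M $$ (j, k)"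
begin

lemma diag_eq_iff: "i < n \<Longrightarrow> j < n \<Longrightarrow> k < n \<Longrightarrow>
    M $$ (i, i) = M $$ (j, k) \<longleftrightarrow> j = k \<and> M $$ (i, i) = M $$ (j, j)"
  using diag by auto

text \<open>By symmetry a closed walk of length 2 reads the same label twice, whereas for distinct
  ends the walk resting at \<open>u'\<close> first reads a diagonal label and then a different
  one.\<close>

lemma walk_pairs_eq_imp_diag:
  assumes lt: "u < n" "u' < n" "v' < n" and eq: "walk_pairs n M u u = walk_pairs n M u' v'"
  shows "u' = v'"
proof (rule ccontr)
  assume "u' \<noteq> v'"
  have "{#M $$ (u', u'), M $$ (u', v')#} \<in># walk_pairs n M u u"
    unfolding eq using lt by (auto simp: in_walk_pairs_iff)
  then obtain k where "k < n" "{#M $$ (u', u'), M $$ (u', v')#} = {#M $$ (u, k), M $$ (k, u)#}"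
    by (auto simp: in_walk_pairs_iff)
  then have "M $$ (u', u') = M $$ (u', v')"
    using sym[of u k] lt by (auto simp: mset_pair_eq_iff)
  then show False
    using diag lt \<open>u' \<noteq> v'\<close> by blast
qed

text \<open>Only the walks with middle vertex \<open>u\<close> or \<open>v\<close> meet a diagonal
  label. The filter refers to no particular ends, so it can be applied to both sides of an equation
  between walk multisets.\<close>

lemma walk_pairs_diag_part:
  assumes "u < n" "v < n" "u \<noteq> v"
  shows "filter_mset (\<lambda>p. \<exists>i<n. M $$ (i, i) \<in># p) (walk_pairs n M u v) =
    {#{#M $$ (u, u), M $$ (u, v)#}, {#M $$ (v, v), M $$ (u, v)#}#}"
proof -
  have "{k \<in> {0..<n}. \<exists>i<n. M $$ (i, i) \<in># {#M $$ (u, k), M $$ (k, v)#}} = {u, v}"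
  proof (intro equalityI subsetI)
    fix k assume "k \<in> {k \<in> {0..<n}. \<exists>i<n. M $$ (i, i) \<in># {#M $$ (u, k), M $$ (k, v)#}}"
    then obtain i where "i < n" "k < n" "M $$ (i, i) = M $$ (u, k) \<or> M $$ (i, i) = M $$ (k, v)"
      by auto
    then show "k \<in> {u, v}"
      using diag[of i u k] diag[of i k v] assms by blast
  qed (use assms in auto)
  moreover have "mset_set {u, v} = {#u, v#}"
    using assms by simp
  ultimately show ?thesis
    by (simp add: walk_pairs_def filter_mset_image_mset add_mset_commute)
qed

lemma walk_pairs_eqD:
  assumes lt: "u < n" "v < n" "u' < n" "v' < n"
    and eq: "walk_pairs n M u v = walk_pairs n M u' v'"
  shows "u = v \<longleftrightarrow> u' = v'"
    and "M $$ (u, v) = M $$ (u', v')"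
    and "{#M $$ (u, u), M $$ (v, v)#} = {#M $$ (u', u'), M $$ (v', v')#}"
proof -
  show iff: "u = v \<longleftrightarrow> u' = v'"
    using walk_pairs_eq_imp_diag[of u u' v'] walk_pairs_eq_imp_diag[of u' u v] lt eq by metis
  have "M $$ (u, v) = M $$ (u', v') \<and>
    {#M $$ (u, u), M $$ (v, v)#} = {#M $$ (u', u'), M $$ (v', v')#}"
  proof (cases "u = v")
    case True
    \<comment> \<open>The walk resting at \<open>u\<close> contributes this pair. Any walk at
      \<open>u'\<close> reading the same label rests at \<open>u'\<close>, because a diagonal label
      forces \<open>k = u'\<close>.\<close>
    then have "{#M $$ (u, u), M $$ (u, u)#} \<in># walk_pairs n M u' u'"
      unfolding in_walk_pairs_iff using eq iff lt by (metis in_walk_pairs_iff)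
    then obtain k where "k < n" "M $$ (u, u) = M $$ (u', k)"
      by (auto simp: in_walk_pairs_iff mset_pair_eq_iff)
    then show ?thesis
      using True iff diag_eq_iff[of u u' k] lt by (metis (no_types))
  next
    case False
    \<comment> \<open>These inequalities exclude crosswise matchings: within equal pairs, diagonal
      labels correspond to diagonal labels.\<close>
    then have neq: "M $$ (u, u) \<noteq> M $$ (u', v')" "M $$ (v, v) \<noteq> M $$ (u', v')"
      using iff diag lt by auto
    have "{#{#M $$ (u, u), M $$ (u, v)#}, {#M $$ (v, v), M $$ (u, v)#}#} =
        {#{#M $$ (u', u'), M $$ (u', v')#}, {#M $$ (v', v'), M $$ (u', v')#}#}"
      using walk_pairs_diag_part[of u v] walk_pairs_diag_part[of u' v'] lt eq False iff by simp
    then show ?thesis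
      using neq by (auto simp: mset_pair_eq_iff)
  qed
  then show "M $$ (u, v) = M $$ (u', v')"
    and "{#M $$ (u, u), M $$ (v, v)#} = {#M $$ (u', u'), M $$ (v', v')#}"
    by auto
qed

lemma col_labels_eq_row_labels:
  assumes "C \<subseteq> {0..<n}" "v < n"
  shows "col_labels M C v = row_labels M v C"
proof -
  have "finite C"
    using assms(1) by (rule finite_subset) simp
  then show ?thesis
    unfolding col_labels_def row_labels_def
    using assms sym by (intro image_mset_cong) auto
qed

end

section \<open>Labellings that squaring does not refine further\<close>

locale stable_labelling = diag_separated +
  assumes stable: "\<And>i j k l. i < n \<Longrightarrow> j < n \<Longrightarrow> k < n \<Longrightarrow> l < n \<Longrightarrow>
    M $$ (i, j) = M $$ (k, l) \<Longrightarrow> walk_pairs n M i j = walk_pairs n M k l"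
begin

text \<open>An edge label fixes the unordered pair of its end labels, so knowing one end label
  leaves only one value for the other.\<close>

lemma end_label_determined:
  assumes lt: "i < n" "j < n" "k < n" "l < n"
    and "M $$ (i, j) = M $$ (k, l)" "M $$ (i, i) = M $$ (k, k)"
  shows "M $$ (j, j) = M $$ (l, l)"
  using walk_pairs_eqD(3)[OF lt stable[OF lt assms(5)]] assms(6)
  by simp

text \<open>Closed walks of length 2 go out and back along one edge, so the walk multiset at a
  vertex is its row with every label doubled, and doubling is injective.\<close>

lemma row_labels_eq:
  assumes "i < n" "j < n" "M $$ (i, i) = M $$ (j, j)"
  shows "row_labels M i {0..<n} = row_labels M j {0..<n}"
proof -
  define sq where "sq x = {#x, x#}" for x :: 'a
  have "inj sq"
    by (auto simp: sq_def inj_def mset_pair_eq_iff)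
  have wp: "walk_pairs n M k k = image_mset sq (row_labels M k {0..<n})" if "k < n" for k
    using that sym[of k]
    by (auto simp: walk_pairs_def row_labels_def sq_def multiset.map_comp comp_def
        intro!: image_mset_cong)
  have "image_mset sq (row_labels M i {0..<n}) = image_mset sq (row_labels M j {0..<n})"
    using stable[of i i j j] assms wp by simp
  then show ?thesis
    using multiset.inj_map[OF \<open>inj sq\<close>] by (simp add: inj_eq)
qed

text \<open>The filter predicate depends on \<open>i\<close> only through its label, so equality of
  whole rows restricts to equality on each cell.\<close>

lemma row_labels_cell_eq_filter:
  assumes "i < n"
  shows "row_labels M i {v \<in> {0..<n}. M $$ (v, v) = d} =
    filter_mset (\<lambda>l. \<exists>a<n. \<exists>b<n. M $$ (a, a) = M $$ (i, i) \<and> M $$ (b, b) = d \<and> l = M $$ (a, b))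
      (row_labels M i {0..<n})"
proof -
  \<comment> \<open>Forwards, \<open>a = i\<close> and \<open>b = v\<close> are witnesses;
    backwards, \<open>end_label_determined\<close> carries the label \<open>d\<close> from
    \<open>b\<close> to \<open>v\<close>.\<close>
  have "{v \<in> {0..<n}. M $$ (v, v) = d} = {v \<in> {0..<n}.
      \<exists>a<n. \<exists>b<n. M $$ (a, a) = M $$ (i, i) \<and> M $$ (b, b) = d \<and> M $$ (i, v) = M $$ (a, b)}"
    using assms end_label_determined by (smt (verit) Collect_cong atLeastLessThan_iff zero_le)
  then show ?thesis
    by (simp add: row_labels_def filter_mset_image_mset)
qed

lemma row_labels_cell_eq:
  assumes "i < n" "j < n" "M $$ (i, i) = M $$ (j, j)" "C \<in> vertex_partition n M"
  shows "row_labels M i C = row_labels M j C"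
proof -
  obtain d where C: "C = {v \<in> {0..<n}. M $$ (v, v) = d}"
    using assms(4) by (auto simp: vertex_partition_def)
  show ?thesis
    unfolding C row_labels_cell_eq_filter[OF assms(1)] row_labels_cell_eq_filter[OF assms(2)]
    by (simp only: row_labels_eq[OF assms(1-3)] assms(3))
qed

lemma vertex_partition_subset: "C \<in> vertex_partition n M \<Longrightarrow> C \<subseteq> {0..<n}"
  by (auto simp: vertex_partition_def)

lemma vertex_partition_finite: "C \<in> vertex_partition n M \<Longrightarrow> finite C"
  by (auto simp: vertex_partition_def)

lemma vertex_partition_less: "C \<in> vertex_partition n M \<Longrightarrow> i \<in> C \<Longrightarrow> i < n"
  by (auto simp: vertex_partition_def)

lemma vertex_partition_cell_eq:
  "C \<in> vertex_partition n M \<Longrightarrow> i \<in> C \<Longrightarrow> C = {v \<in> {0..<n}. M $$ (v, v) = M $$ (i, i)}"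
  by (auto simp: vertex_partition_def)

lemma vertex_partition_label_eq:
  "C \<in> vertex_partition n M \<Longrightarrow> i \<in> C \<Longrightarrow> j \<in> C \<Longrightarrow> M $$ (i, i) = M $$ (j, j)"
  by (auto simp: vertex_partition_def)

lemma row_labels_vertex_partition_eq:
  assumes "Cu \<in> vertex_partition n M" "Cv \<in> vertex_partition n M" "i \<in> Cu" "j \<in> Cu"
  shows "row_labels M i Cv = row_labels M j Cv"
  using assms vertex_partition_label_eq vertex_partition_less
  by (intro row_labels_cell_eq) blast+

lemma equitable_vertex_partition: "equitable n M (vertex_partition n M)"
  unfolding equitable_def
proof (intro conjI ballI allI impI)
  show "partition_on {0..<n} (vertex_partition n M)"
    by (rule partition_onI) (auto simp: vertex_partition_def disjnt_def)
next
  fix i j assume "i < n" "j < n" "M $$ (i, i) = M $$ (j, j)"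
  then show "\<exists>C\<in>vertex_partition n M. i \<in> C \<and> j \<in> C"
    by (auto simp: vertex_partition_def)
next
  fix Cu Cv i j
  assume "Cu \<in> vertex_partition n M" "Cv \<in> vertex_partition n M" "i \<in> Cu" "j \<in> Cu"
  then show "row_labels M i Cv = row_labels M j Cv"
    by (rule row_labels_vertex_partition_eq)
next
  fix Cu Cv i j
  assume C: "Cu \<in> vertex_partition n M" "Cv \<in> vertex_partition n M" "i \<in> Cv" "j \<in> Cv"
  then have "i < n" "j < n"
    using vertex_partition_less by blast+
  then show "col_labels M Cu i = col_labels M Cu j"
    using C row_labels_vertex_partition_eq[OF C(2,1,3,4)] vertex_partition_subset
    by (simp add: col_labels_eq_row_labels)
qed

text \<open>Two edges at \<open>u\<close> with a common label have far ends with equal labels, hence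
  in the same cell.\<close>

lemma row_labels_disjoint:
  assumes "u < n" "Cv \<in> vertex_partition n M" "Cw \<in> vertex_partition n M" "Cv \<noteq> Cw"
  shows "row_labels M u Cv \<inter># row_labels M u Cw = {#}"
proof -
  have False if "v \<in> Cv" "w \<in> Cw" "M $$ (u, v) = M $$ (u, w)" for v w
  proof -
    have "v < n" "w < n"
      using that assms vertex_partition_less by blast+
    then have "M $$ (v, v) = M $$ (w, w)"
      using end_label_determined[of u v u w] that assms by simp
    then show False
      using vertex_partition_cell_eq[OF assms(2) that(1)]
        vertex_partition_cell_eq[OF assms(3) that(2)] assms(4) by simp
  qed
  moreover have "finite Cv" "finite Cw"
    using assms vertex_partition_finite by blast+
  ultimately show ?thesis
    by (auto simp: row_labels_def disjunct_not_in)
qed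

lemma strongly_equitable_vertex_partition: "strongly_equitable n M (vertex_partition n M)"
  unfolding strongly_equitable_def
proof (intro conjI ballI impI equitable_vertex_partition)
  fix Cu Cv Cw u
  assume C: "Cu \<in> vertex_partition n M" "Cv \<in> vertex_partition n M" "Cw \<in> vertex_partition n M"
    "Cv \<noteq> Cw" "u \<in> Cu"
  then have "u < n"
    using vertex_partition_less by blast
  then show "row_labels M u Cv \<inter># row_labels M u Cw = {#}"
    using C row_labels_disjoint by blast
  then show "col_labels M Cv u \<inter># col_labels M Cw u = {#}"
    using C \<open>u < n\<close> vertex_partition_subset by (simp add: col_labels_eq_row_labels)
qed

text \<open>The row labels of \<open>v\<close> towards the cell \<open>{u}\<close> form a
  one-element multiset, which is the same for all vertices in the cell of \<open>v\<close>; symmetry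
  turns it into the label from \<open>u\<close>.\<close>

lemma singleton_cell_labels_eq:
  assumes "{u} \<in> vertex_partition n M" "C \<in> vertex_partition n M" "v \<in> C" "v' \<in> C"
  shows "M $$ (u, v) = M $$ (u, v')"
proof -
  have "u < n" "v < n" "v' < n"
    using assms vertex_partition_less by blast+
  then show ?thesis
    using row_labels_vertex_partition_eq[OF assms(2,1,3,4)] sym[of u v] sym[of u v']
    by (simp add: row_labels_def)
qed

text \<open>Off the diagonal the labels of \<open>M\<close> refine those of \<open>A\<close>, so
  adjacency in \<open>A\<close> can be read from the label in \<open>M\<close>, and counting
  neighbours becomes counting labels in a row.\<close>

lemma card_neighbours_eq:
  fixes A :: "label_poly mat"
  assumes A: "A \<in> carrier_mat n n"
    and refine: "\<And>i j k l. i < n \<Longrightarrow> j < n \<Longrightarrow> k < n \<Longrightarrow> l < n \<Longrightarrow> i \<noteq> j \<Longrightarrow>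
      M $$ (i, j) = M $$ (k, l) \<Longrightarrow> A $$ (i, j) = A $$ (k, l)"
    and C: "Cu \<in> vertex_partition n M" "Cv \<in> vertex_partition n M" "w \<in> Cu" "w' \<in> Cu"
  shows "card (neighbours A w \<inter> Cv) = card (neighbours A w' \<inter> Cv)"
proof -
  \<comment> \<open>The labels that \<open>M\<close> gives to the adjacent pairs of
    \<open>A\<close>.\<close>
  define L where "L = {M $$ (i, j) | i j. i < n \<and> j < n \<and> i \<noteq> j \<and> A $$ (i, j) \<noteq> indet 0}"
  have card: "card (neighbours A w \<inter> Cv) = size (filter_mset (\<lambda>l. l \<in> L) (row_labels M w Cv))"
    if "w < n" for w
  proof -
    have "neighbours A w \<inter> Cv = {v \<in> Cv. M $$ (w, v) \<in> L}"
    proof (intro equalityI subsetI)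
      fix v assume "v \<in> neighbours A w \<inter> Cv"
      then show "v \<in> {v \<in> Cv. M $$ (w, v) \<in> L}"
        using A that by (auto simp: neighbours_def L_def)
    next
      fix v assume v: "v \<in> {v \<in> Cv. M $$ (w, v) \<in> L}"
      then obtain i j where ij: "i < n" "j < n" "i \<noteq> j" "A $$ (i, j) \<noteq> indet 0"
        "M $$ (i, j) = M $$ (w, v)"
        by (auto simp: L_def)
      have "v < n"
        using v C vertex_partition_less by blast
      \<comment> \<open>Labels in \<open>L\<close> come from off-diagonal positions, so they cannot
        occur at \<open>(w, w)\<close>.\<close>
      moreover have "v \<noteq> w"
        using diag[of w i j] ij that by auto
      moreover have "A $$ (w, v) \<noteq> indet 0"
        using refine[OF ij(1,2) that \<open>v < n\<close> ij(3,5)] ij(4) by simp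
      ultimately show "v \<in> neighbours A w \<inter> Cv"
        using v A by (auto simp: neighbours_def)
    qed
    moreover have "finite Cv"
      using C vertex_partition_finite by blast
    ultimately show ?thesis
      by (simp add: row_labels_def filter_mset_image_mset)
  qed
  have "w < n" "w' < n"
    using C vertex_partition_less by blast+
  then show ?thesis
    using card row_labels_vertex_partition_eq[OF C] by simp
qed

end

section \<open>Invariants of the SaS process\<close>

lemma diag_equiv_subst_diag_separated:
  assumes "is_graph n A" "diag_equiv_subst n A B"
  shows "diag_separated n B" and "elements_mat B \<subseteq> range indet"
proof -
  have A: "A \<in> carrier_mat n n" "transpose_mat A = A"
    and elts: "elements_mat A \<subseteq> insert (indet 0) Var"
    using assms(1) by (auto simp: is_graph_def)
  have B: "B \<in> carrier_mat n n"
    and off: "\<And>i j. i < n \<Longrightarrow> j < n \<Longrightarrow> i \<noteq> j \<Longrightarrow> B $$ (i, j) = A $$ (i, j)"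
    and diag_Var: "\<And>i. i < n \<Longrightarrow> B $$ (i, i) \<in> Var"
    and fresh: "\<And>i j k. i < n \<Longrightarrow> j < n \<Longrightarrow> k < n \<Longrightarrow> j \<noteq> k \<Longrightarrow> B $$ (i, i) \<noteq> A $$ (j, k)"
    using assms(2) by (auto simp: diag_equiv_subst_def)
  have symA: "A $$ (i, j) = A $$ (j, i)" if "i < n" "j < n" for i j
    using A that by (metis carrier_matD index_transpose_mat(1))
  show "diag_separated n B"
  proof
    fix i j assume "i < n" "j < n"
    then show "B $$ (i, j) = B $$ (j, i)"
      using off symA by (cases "i = j") auto
  qed (use B off fresh in auto)
  show "elements_mat B \<subseteq> range indet"
  proof
    fix x assume "x \<in> elements_mat B"
    then obtain i j where ij: "i < n" "j < n" "x = B $$ (i, j)"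
      using B by (auto simp: elements_mat_def)
    have "A $$ (i, j) \<in> elements_mat A"
      using elements_matI[OF A(1) ij(1,2) refl] .
    with elts have "A $$ (i, j) \<in> insert (indet 0) Var"
      by blast
    then have "x \<in> insert (indet 0) Var"
      using ij off diag_Var by (metis insertI2)
    then show "x \<in> range indet"
      unfolding Var_def by blast
  qed
qed

lemma equiv_subst_pow_mat_2_walk_pairs_eq:
  assumes "M \<in> carrier_mat n n" "elements_mat M \<subseteq> range indet" "equiv_subst (M ^\<^sub>m 2) N"
    and "i < n" "j < n" "k < n" "l < n" "N $$ (i, j) = N $$ (k, l)"
  shows "walk_pairs n M i j = walk_pairs n M k l"
  using assms by (intro pow_mat_2_eq_imp_walk_pairs_eq) (auto simp: equiv_subst_def)

text \<open>Commutativity of the ring keeps the square symmetric; separation persists because walk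
  multisets distinguish closed walks from open ones.\<close>

lemma equiv_subst_pow_mat_2_diag_separated:
  assumes "diag_separated n M" "elements_mat M \<subseteq> range indet" "equiv_subst (M ^\<^sub>m 2) N"
  shows "diag_separated n N" and "elements_mat N \<subseteq> range indet"
proof -
  interpret diag_separated n M by fact
  note walk = equiv_subst_pow_mat_2_walk_pairs_eq[OF carrier assms(2,3)]
  have dims: "dim_row (M ^\<^sub>m 2) = n" "dim_col (M ^\<^sub>m 2) = n"
    using carrier by auto
  show "diag_separated n N"
  proof
    show "N \<in> carrier_mat n n"
      using assms(3) dims by (simp add: equiv_subst_def)
  next
    fix i j assume ij: "i < n" "j < n"
    have "(M ^\<^sub>m 2) $$ (i, j) = (M ^\<^sub>m 2) $$ (j, i)"
      using ij sym by (auto simp: index_pow_mat_2[OF carrier] mult.commute intro!: sum.cong)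
    then show "N $$ (i, j) = N $$ (j, i)"
      using assms(3) dims ij by (simp add: equiv_subst_def)
  next
    fix i j k assume "i < n" "j < n" "k < n" "j \<noteq> k"
    then show "N $$ (i, i) \<noteq> N $$ (j, k)"
      using walk walk_pairs_eqD(1) by blast
  qed
  show "elements_mat N \<subseteq> range indet"
    using assms(3) by (auto simp: equiv_subst_def Var_def)
qed

lemma mat_dim_eq_card_image:
  "M \<in> carrier_mat n n \<Longrightarrow> mat_dim M = card ((\<lambda>p. M $$ p) ` ({0..<n} \<times> {0..<n}))"
  unfolding mat_dim_def elements_mat_def by (rule arg_cong[of _ _ card]) force

theorem theorem5:
  fixes n :: nat and A X :: "label_poly mat"
  assumes "is_graph n A" and "is_stable_graph n A X"
  shows "strongly_equitable n X (vertex_partition n X) \<and>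
    (\<forall>u. {u} \<in> vertex_partition n X \<longrightarrow>
       (\<forall>C \<in> vertex_partition n X. \<forall>v \<in> C. \<forall>v' \<in> C. X $$ (u, v) = X $$ (u, v'))) \<and>
    (\<forall>Cu \<in> vertex_partition n X. \<forall>Cv \<in> vertex_partition n X. \<forall>w \<in> Cu. \<forall>w' \<in> Cu.
       card (neighbours A w \<inter> Cv) = card (neighbours A w' \<inter> Cv))"
proof -
  obtain S t where start: "diag_equiv_subst n A (S 1)"
    and subst: "\<And>i. i \<ge> 1 \<Longrightarrow> equiv_subst (S i ^\<^sub>m 2) (S (Suc i))"
    and t: "t \<ge> 1" "mat_dim (S t) = mat_dim (S (Suc t))" and X: "X = S t"
    using assms(2) unfolding is_stable_graph_def SaS_sequence_def by auto
  have sep: "diag_separated n (S i) \<and> elements_mat (S i) \<subseteq> range indet" if "i \<ge> 1" for i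
    using that
  proof (induction i rule: dec_induct)
    case base
    then show ?case
      using diag_equiv_subst_diag_separated[OF assms(1) start] by simp
  next
    case (step i)
    then show ?case
      using equiv_subst_pow_mat_2_diag_separated subst by blast
  qed
  have walk: "walk_pairs n (S m) i j = walk_pairs n (S m) k l"
    if "m \<ge> 1" "i < n" "j < n" "k < n" "l < n" "S (Suc m) $$ (i, j) = S (Suc m) $$ (k, l)"
    for m i j k l
    using equiv_subst_pow_mat_2_walk_pairs_eq[OF diag_separated.carrier[OF conjunct1[OF sep]]
        conjunct2[OF sep] subst] that by metis
  have refine: "S m $$ (i, j) = S m $$ (k, l)"
    if "m \<ge> 1" "i < n" "j < n" "k < n" "l < n" "S (Suc m) $$ (i, j) = S (Suc m) $$ (k, l)"
    for m i j k l
    using diag_separated.walk_pairs_eqD(2)[OF conjunct1[OF sep]] walk that by metis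
  interpret X: diag_separated n X
    using sep t X by simp
  \<comment> \<open>The step after \<open>t\<close> refines \<open>X\<close> and has equally many
    labels, so both labellings have the same classes of vertex pairs.\<close>
  have "S (Suc t) $$ (i, j) = S (Suc t) $$ (k, l)"
    if "i < n" "j < n" "k < n" "l < n" "X $$ (i, j) = X $$ (k, l)" for i j k l
  proof (rule kernel_eq_if_card_image_eq[where P = "{0..<n} \<times> {0..<n}" and h = "\<lambda>p. X $$ p"])
    show "card ((\<lambda>p. S (Suc t) $$ p) ` ({0..<n} \<times> {0..<n})) =
        card ((\<lambda>p. X $$ p) ` ({0..<n} \<times> {0..<n}))"
      using t X sep[of "Suc t"] X.carrier
      by (simp add: mat_dim_eq_card_image[symmetric] diag_separated.carrier)
  next
    fix p q
    assume "p \<in> {0..<n} \<times> {0..<n}" "q \<in> {0..<n} \<times> {0..<n}" "S (Suc t) $$ p = S (Suc t) $$ q"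
    then show "X $$ p = X $$ q"
      unfolding X by (cases p; cases q) (simp add: refine[OF t(1)])
  qed (use that in simp_all)
  then interpret X: stable_labelling n X
    by unfold_locales (use walk[OF t(1)] X in metis)
  \<comment> \<open>Refinement is iterated back to \<open>S 1\<close>, which agrees with
    \<open>A\<close> off the diagonal.\<close>
  have refine1: "S m $$ (i, j) = S m $$ (k, l) \<longrightarrow> S 1 $$ (i, j) = S 1 $$ (k, l)"
    if "m \<ge> 1" "i < n" "j < n" "k < n" "l < n" for m i j k l
    using that(1)
  proof (induction m rule: dec_induct)
    case (step m)
    then show ?case
      using refine that(2-5) by metis
  qed simp
  have A: "A \<in> carrier_mat n n"
    using assms(1) by (simp add: is_graph_def)
  have off: "A $$ (i, j) = A $$ (k, l)"
    if lt: "i < n" "j < n" "k < n" "l < n" and "i \<noteq> j" "X $$ (i, j) = X $$ (k, l)" for i j k l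
  proof -
    \<comment> \<open>Both positions must be off the diagonal before \<open>S 1\<close> can be
      replaced by \<open>A\<close>.\<close>
    have "k \<noteq> l"
      using X.diag[of k i j] that by auto
    moreover have "S 1 $$ (i, j) = S 1 $$ (k, l)"
      using refine1[OF t(1) lt] that X by simp
    ultimately show ?thesis
      using start that by (simp add: diag_equiv_subst_def)
  qed
  show ?thesis
    using X.strongly_equitable_vertex_partition X.singleton_cell_labels_eq
      X.card_neighbours_eq[OF A off] by blast
qed

end
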